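(* Let $c\ge0$ and let $N$ be an $\mathrm{SU}(2)$-invariant submanifold determined by a curve $\tau\mapsto(\alpha(\tau),\beta(\tau),s(\tau),t(\tau),\delta(\tau))$ as described in the context. Then $N$ is Cayley (up to orientation) with respect to $\Phi_c$ in the chart $\mathcal{U}$ if and only if the following quantities are constant (in $\tau$): $$\beta,\qquad \delta,\qquad \frac{s}{t},\qquad F:=2\sin^{5/2}\alpha\,\cos^{1/2}\alpha\; st+5c\,\frac{st}{s^2+t^2}\,H(\alpha),$$ where $H(\alpha)$ is the primitive function of $h(\alpha):=(\cos\alpha\sin\alpha)^{3/2}$.
   Context: **Coordinates.** $S^4\subset\mathbb{R}^3\oplus\mathbb{R}^2$ is the unit round sphere; points are written $(\cos\alpha\,\mathbf{u},\sin\alpha\,\mathbf{v})$ with $\mathbf{u}=(\cos\theta,\sin\theta\cos\phi,\sin\theta\sin\phi)\in S^2$, $\mathbf{v}=(\cos\beta,\sin\beta)\in S^1$, $\alpha\in(0,\pi/2)$, $\theta\in(0,\pi)$, $\phi,\beta\in[0,2\pi)$. Use the oriented orthonormal coframe $b_0=d\alpha$, $b_1=\sin\alpha\,d\beta$, $b_2=\cos\alpha\,d\theta$, $b_3=\cos\alpha\sin\theta\,d\phi$. $M$ is the (rank 4 real) negative spinor bundle of $S^4$; in the trivialization induced by this frame it has linear fibre coordinates $(a_0,a_1,a_2,a_3)$. With $2\rho_1=-\cos\alpha\,d\beta+\cos\theta\,d\phi$, $2\rho_2=\sin\alpha\,d\theta$, $2\rho_3=\sin\alpha\sin\theta\,d\phi$,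 the vertical 1-forms are $\xi_0=da_0+\rho_1a_1+\rho_2a_2+\rho_3a_3$, $\xi_1=da_1-\rho_1a_0-\rho_3a_2+\rho_2a_3$, $\xi_2=da_2-\rho_2a_0+\rho_3a_1-\rho_1a_3$, $\xi_3=da_3-\rho_3a_0-\rho_2a_1+\rho_1a_2$. **Cayley form.** With $(i,j,k)$ cyclic permutations of $(1,2,3)$, $\Omega_i=b_0\wedge b_i-b_j\wedge b_k$, $A_i=\xi_0\wedge\xi_i-\xi_j\wedge\xi_k$, $r^2=\sum a_i^2$, $$\Phi_c=16(c+r^2)^{-4/5}\xi_0\wedge\xi_1\wedge\xi_2\wedge\xi_3+25(c+r^2)^{6/5}b_0\wedge b_1\wedge b_2\wedge b_3+20(c+r^2)^{1/5}\sum_{i=1}^3A_i\wedge\Omega_i,$$ with induced metric $g_c=4(c+r^2)^{-2/5}\sum\xi_i^2+5(c+r^2)^{3/5}\sum b_i^2$. A 4-dimensional oriented submanifold $N$ is Cayley if $\Phi_c|_N=\mathrm{vol}_N$. **Adapted chart.** The fibre coordinates are rewritten as $a_0=s\cos\frac{\delta-\gamma}{2}$, $a_1=s\sin\frac{\delta-\gamma}{2}$, $a_2=t\cos\frac{\delta+\gamma}{2}$, $a_3=t\sin\frac{\delta+\gamma}{2}$, with $s,t>0$, $\gamma\in[0,4\pi)$, $\delta\in[0,2\pi)$. $\mathcal{U}$ is the chart of $M$ with coordinates $(\alpha,\beta,\theta,\phi,s,t,\delta,\gamma)$, where $\alpha\in(0,\pi/2)$, $s,t>0$. The lift to $M$ of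 the standard $\mathrm{SO}(3)\times\mathrm{Id}_2$ action on $S^4$ is an $\mathrm{SU}(2)$ action whose orbits in this chart are parametrized by $(\theta,\phi,\gamma)$. **The submanifold $N$.** For a smooth curve $(\alpha(\tau),\beta(\tau),s(\tau),t(\tau),\delta(\tau))$, $\tau\in(-\epsilon,\epsilon)$ (with nowhere zero derivative, so that $N$ is 4-dimensional), $N$ is the union over $\tau$ of the $\mathrm{SU}(2)$-orbits, i.e. the set of points with base point $(\cos\alpha(\tau)\mathbf{u},\sin\alpha(\tau)\mathbf{v}(\tau))$, $\mathbf{v}(\tau)=(\cos\beta(\tau),\sin\beta(\tau))$, and fibre coordinates $\big(s\cos\frac{\delta-\gamma}{2},s\sin\frac{\delta-\gamma}{2},t\cos\frac{\delta+\gamma}{2},t\sin\frac{\delta+\gamma}{2}\big)$ evaluated at $\tau$, for $\mathbf{u}\in S^2$, $\gamma\in[0,4\pi)$, $\tau\in(-\epsilon,\epsilon)$. Its tangent space is the span of the tangent space of the orbit and $\dot s\partial_s+\dot t\partial_t+\dot\alpha\partial_\alpha+\dot\beta\partial_\beta+\dot\delta\partial_\delta$. *)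

theory Defs
  imports "HOL-Analysis.Analysis"
begin

text \<open>A \<open>k\<close>-form at a point is represented by its value on a sequence of tangent vectors, of which
  only the entries with index \<open>0, \<dots>, k - 1\<close> matter. The wedge product of a \<open>k\<close>-form and an \<open>l\<close>-form
  is normalised so that \<open>(\<mu> \<and> \<nu>)(u, v) = \<mu>(u) \<nu>(v) - \<mu>(v) \<nu>(u)\<close> for 1-forms.\<close>

type_synonym 'v form = "(nat \<Rightarrow> 'v) \<Rightarrow> real"

definition wedge :: "nat \<Rightarrow> nat \<Rightarrow> 'v form \<Rightarrow> 'v form \<Rightarrow> 'v form" where
  "wedge k l \<omega> \<eta> = (\<lambda>v.
     (\<Sum>p | p permutes {..<k + l}.
        of_int (sign p) * \<omega> (\<lambda>i. v (p i)) * \<eta> (\<lambda>i. v (p (k + i)))) / (fact k * fact l))"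

abbreviation wedge1 :: "'v form \<Rightarrow> 'v form \<Rightarrow> 'v form"  (infixl \<open>\<and>\<^sub>1\<close> 72) where
  "\<mu> \<and>\<^sub>1 \<nu> \<equiv> wedge 1 1 \<mu> \<nu>"

abbreviation wedge2 :: "'v form \<Rightarrow> 'v form \<Rightarrow> 'v form"  (infixl \<open>\<and>\<^sub>2\<close> 71) where
  "\<omega> \<and>\<^sub>2 \<eta> \<equiv> wedge 2 2 \<omega> \<eta>"

text \<open>Points of the negative spinor bundle of \<open>S\<^sup>4\<close> over the coordinate domain of
  \<open>(\<alpha>, \<beta>, \<theta>, \<phi>)\<close>, in the trivialisation given there, have coordinates
  \<open>(\<alpha>, \<beta>, \<theta>, \<phi>, a\<^sub>0, a\<^sub>1, a\<^sub>2, a\<^sub>3)\<close>; tangent vectors are written in the corresponding coordinate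
  basis.\<close>

type_synonym coords = "real \<times> real \<times> real \<times> real \<times> real \<times> real \<times> real \<times> real"

fun base_coframe :: "coords \<Rightarrow> nat \<Rightarrow> coords \<Rightarrow> real" where
  "base_coframe (\<alpha>, \<beta>, \<theta>, \<phi>, a0, a1, a2, a3) i (d\<alpha>, d\<beta>, d\<theta>, d\<phi>, da0, da1, da2, da3) =
     [d\<alpha>, sin \<alpha> * d\<beta>, cos \<alpha> * d\<theta>, cos \<alpha> * sin \<theta> * d\<phi>] ! i"

fun vertical_coframe :: "coords \<Rightarrow> nat \<Rightarrow> coords \<Rightarrow> real" where
  "vertical_coframe (\<alpha>, \<beta>, \<theta>, \<phi>, a0, a1, a2, a3) i (d\<alpha>, d\<beta>, d\<theta>, d\<phi>, da0, da1, da2, da3) =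
     (let \<rho>1 = (- cos \<alpha> * d\<beta> + cos \<theta> * d\<phi>) / 2;
          \<rho>2 = sin \<alpha> * d\<theta> / 2;
          \<rho>3 = sin \<alpha> * sin \<theta> * d\<phi> / 2
      in [da0 + \<rho>1 * a1 + \<rho>2 * a2 + \<rho>3 * a3,
          da1 - \<rho>1 * a0 - \<rho>3 * a2 + \<rho>2 * a3,
          da2 - \<rho>2 * a0 + \<rho>3 * a1 - \<rho>1 * a3,
          da3 - \<rho>3 * a0 - \<rho>2 * a1 + \<rho>1 * a2] ! i)"

fun radius_sq :: "coords \<Rightarrow> real" where
  "radius_sq (\<alpha>, \<beta>, \<theta>, \<phi>, a0, a1, a2, a3) = a0\<^sup>2 + a1\<^sup>2 + a2\<^sup>2 + a3\<^sup>2"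

definition base_form :: "coords \<Rightarrow> nat \<Rightarrow> coords form" where
  "base_form x i = (\<lambda>v. base_coframe x i (v 0))"

definition vertical_form :: "coords \<Rightarrow> nat \<Rightarrow> coords form" where
  "vertical_form x i = (\<lambda>v. vertical_coframe x i (v 0))"

definition Omega_form :: "coords \<Rightarrow> nat \<times> nat \<times> nat \<Rightarrow> coords form" where
  "Omega_form x = (\<lambda>(i, j, k) v.
     (base_form x 0 \<and>\<^sub>1 base_form x i) v - (base_form x j \<and>\<^sub>1 base_form x k) v)"

definition A_form :: "coords \<Rightarrow> nat \<times> nat \<times> nat \<Rightarrow> coords form" where
  "A_form x = (\<lambda>(i, j, k) v.
     (vertical_form x 0 \<and>\<^sub>1 vertical_form x i) v - (vertical_form x j \<and>\<^sub>1 vertical_form x k) v)"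

definition cayley_form :: "real \<Rightarrow> coords \<Rightarrow> coords form" where
  "cayley_form c x = (\<lambda>v.
     16 * (c + radius_sq x) powr (- 4 / 5) *
       ((vertical_form x 0 \<and>\<^sub>1 vertical_form x 1) \<and>\<^sub>2 (vertical_form x 2 \<and>\<^sub>1 vertical_form x 3)) v
   + 25 * (c + radius_sq x) powr (6 / 5) *
       ((base_form x 0 \<and>\<^sub>1 base_form x 1) \<and>\<^sub>2 (base_form x 2 \<and>\<^sub>1 base_form x 3)) v
   + 20 * (c + radius_sq x) powr (1 / 5) *
       (\<Sum>ijk\<in>{(1, 2, 3), (2, 3, 1), (3, 1, 2)}. (A_form x ijk \<and>\<^sub>2 Omega_form x ijk) v))"

definition cayley_metric :: "real \<Rightarrow> coords \<Rightarrow> coords \<Rightarrow> coords \<Rightarrow> real" where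
  "cayley_metric c x u v =
     4 * (c + radius_sq x) powr (- 2 / 5) *
       (\<Sum>i<4. vertical_coframe x i u * vertical_coframe x i v)
   + 5 * (c + radius_sq x) powr (3 / 5) *
       (\<Sum>i<4. base_coframe x i u * base_coframe x i v)"

text \<open>A (possibly only immersed) 4-dimensional submanifold is given by a parametrisation \<open>f\<close> on
  \<open>D \<subseteq> \<real>\<^sup>4\<close>. On the coordinate frame, \<open>vol = \<plusminus> sqrt (det g\<^sub>i\<^sub>j)\<close>, where the sign is the choice of
  orientation. For connected \<open>D\<close> this is a single choice, so \<open>\<sigma>\<close> does not depend on the point.\<close>

definition coord_frame :: "(real ^ 4 \<Rightarrow> coords) \<Rightarrow> real ^ 4 \<Rightarrow> 4 \<Rightarrow> coords" where
  "coord_frame f y i = frechet_derivative f (at y) (axis i 1)"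

definition cayley_up_to_orientation :: "real \<Rightarrow> (real ^ 4) set \<Rightarrow> (real ^ 4 \<Rightarrow> coords) \<Rightarrow> bool" where
  "cayley_up_to_orientation c D f \<longleftrightarrow>
     (\<exists>\<sigma>\<in>{1, -1}. \<forall>y\<in>D.
        cayley_form c (f y) (\<lambda>n. coord_frame f y (of_nat (n + 1))) =
          \<sigma> * sqrt (det (\<chi> i j. cayley_metric c (f y) (coord_frame f y i) (coord_frame f y j))))"

definition adapted_chart ::
    "real \<Rightarrow> real \<Rightarrow> real \<Rightarrow> real \<Rightarrow> real \<Rightarrow> real \<Rightarrow> real \<Rightarrow> real \<Rightarrow> coords" where
  "adapted_chart \<alpha> \<beta> \<theta> \<phi> s t \<delta> \<gamma> =
     (\<alpha>, \<beta>, \<theta>, \<phi>,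
      s * cos ((\<delta> - \<gamma>) / 2), s * sin ((\<delta> - \<gamma>) / 2),
      t * cos ((\<delta> + \<gamma>) / 2), t * sin ((\<delta> + \<gamma>) / 2))"

text \<open>The union of the \<open>SU(2)\<close>-orbits through a curve, parametrised by
  \<open>y = (\<theta>, \<phi>, \<gamma>, \<tau>)\<close>; for fixed \<open>\<tau>\<close> it parametrises a single orbit. The angles \<open>\<beta>\<close> and \<open>\<delta>\<close> of the
  curve are arbitrary real-valued lifts.\<close>

definition orbit_param ::
    "(real \<Rightarrow> real) \<Rightarrow> (real \<Rightarrow> real) \<Rightarrow> (real \<Rightarrow> real) \<Rightarrow> (real \<Rightarrow> real) \<Rightarrow> (real \<Rightarrow> real)
       \<Rightarrow> real ^ 4 \<Rightarrow> coords" where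
  "orbit_param \<alpha> \<beta> s t \<delta> y =
     adapted_chart (\<alpha> (y $ 4)) (\<beta> (y $ 4)) (y $ 1) (y $ 2) (s (y $ 4)) (t (y $ 4)) (\<delta> (y $ 4)) (y $ 3)"

definition orbit_domain :: "real \<Rightarrow> (real ^ 4) set" where
  "orbit_domain \<epsilon> =
     {y. y $ 1 \<in> {0<..<pi} \<and> y $ 2 \<in> {0..<2 * pi} \<and> y $ 3 \<in> {0..<4 * pi} \<and> y $ 4 \<in> {-\<epsilon><..<\<epsilon>}}"

text \<open>Only meant for open \<open>S\<close>, where \<open>deriv\<close> depends on the values of \<open>f\<close> on \<open>S\<close> alone.\<close>

definition smooth_on :: "(real \<Rightarrow> real) \<Rightarrow> real set \<Rightarrow> bool" where
  "smooth_on f S \<longleftrightarrow> (\<forall>k. (deriv ^^ k) f differentiable_on S)"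

end

theory Submission
  imports Defs
begin

text \<open>The vector \<open>a\<close> of fibre coordinates and the vertical parts of the \<open>SU(2)\<close>-orbit directions
  \<open>\<partial>\<^sub>\<theta>\<close>, \<open>\<partial>\<^sub>\<phi> - cos \<theta> \<partial>\<^sub>\<gamma>\<close>, \<open>\<partial>\<^sub>\<gamma>\<close> are pairwise orthogonal, so both \<open>\<Phi>\<^sub>c\<close> and the Gram determinant
  of the coordinate frame can be computed explicitly. The difference \<open>vol\<^sup>2 - \<Phi>\<^sub>c\<^sup>2\<close> is then a positive
  combination of the squares of \<open>\<beta>'\<close>, \<open>\<delta>'\<close>, \<open>s' t - s t'\<close> and one further linear expression, which for
  constant \<open>s / t\<close> is a positive multiple of \<open>F'\<close>. So the Cayley condition up to a sign
  at each point says that \<open>\<beta>\<close>, \<open>\<delta>\<close>, \<open>s / t\<close> and \<open>F\<close> are constant. The sign does not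
  vary, because \<open>\<Phi>\<^sub>c\<close> on the frame is a positive multiple of a continuous function of \<open>\<tau>\<close>, which has
  no zero as the curve is regular.\<close>

section \<open>Determinants and wedge products in dimension four\<close>

lemma det_4:
  "det (A :: 'a::comm_ring_1 ^ 4 ^ 4) =
     A$1$1 * (A$2$2 * (A$3$3 * A$4$4 - A$3$4 * A$4$3) - A$2$3 * (A$3$2 * A$4$4 - A$3$4 * A$4$2)
       + A$2$4 * (A$3$2 * A$4$3 - A$3$3 * A$4$2))
   - A$1$2 * (A$2$1 * (A$3$3 * A$4$4 - A$3$4 * A$4$3) - A$2$3 * (A$3$1 * A$4$4 - A$3$4 * A$4$1)
       + A$2$4 * (A$3$1 * A$4$3 - A$3$3 * A$4$1))
   + A$1$3 * (A$2$1 * (A$3$2 * A$4$4 - A$3$4 * A$4$2) - A$2$2 * (A$3$1 * A$4$4 - A$3$4 * A$4$1)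
       + A$2$4 * (A$3$1 * A$4$2 - A$3$2 * A$4$1))
   - A$1$4 * (A$2$1 * (A$3$2 * A$4$3 - A$3$3 * A$4$2) - A$2$2 * (A$3$1 * A$4$3 - A$3$3 * A$4$1)
       + A$2$3 * (A$3$1 * A$4$2 - A$3$2 * A$4$1))"
proof -
  have f234: "finite {2::4, 3, 4}" "1 \<notin> {2::4, 3, 4}"
    and f34: "finite {3::4, 4}" "2 \<notin> {3::4, 4}"
    and f4: "finite {4::4}" "3 \<notin> {4::4}"
    by auto
  show ?thesis
    unfolding det_def UNIV_4
    unfolding sum_over_permutations_insert[OF f234]
    unfolding sum_over_permutations_insert[OF f34]
    unfolding sum_over_permutations_insert[OF f4]
    unfolding permutes_sing
    by (simp add: sign_swap_id permutation_swap_id sign_compose permutation_compose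
        sign_id transpose_apply_other algebra_simps)
qed

lemma wedge1_apply:
  "((\<lambda>v. f (v 0)) \<and>\<^sub>1 (\<lambda>v. g (v 0))) v = f (v 0) * g (v 1) - f (v 1) * g (v 0)"
proof -
  have s: "{..<1 + 1} = insert 0 {1::nat}" by auto
  have n: "finite {1::nat}" "0 \<notin> {1::nat}" by auto
  show ?thesis
    unfolding wedge_def s sum_over_permutations_insert[OF n] permutes_sing
    by (simp add: sign_swap_id permutation_swap_id sign_compose permutation_compose sign_id)
qed

text \<open>Antisymmetry of \<open>f\<close> and \<open>g\<close> groups the 24 permutations into
  six classes of four equal terms, one class for each choice of two arguments for \<open>f\<close>.
  The four copies cancel the normalising factor \<open>fact 2 * fact 2\<close>.\<close>

lemma wedge2_apply:
  assumes "\<And>x y. f y x = - f x y" "\<And>x y. g y x = - g x y"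
  shows "((\<lambda>v. f (v 0) (v 1)) \<and>\<^sub>2 (\<lambda>v. g (v 0) (v 1))) v =
     f (v 0) (v 1) * g (v 2) (v 3) - f (v 0) (v 2) * g (v 1) (v 3) + f (v 0) (v 3) * g (v 1) (v 2)
   + f (v 1) (v 2) * g (v 0) (v 3) - f (v 1) (v 3) * g (v 0) (v 2) + f (v 2) (v 3) * g (v 0) (v 1)"
proof -
  have s: "{..<2 + 2} = insert 0 (insert 1 (insert 2 {3::nat}))" by auto
  have n: "finite {1::nat,2,3}" "0 \<notin> {1::nat,2,3}" "finite {2::nat,3}" "1 \<notin> {2::nat,3}"
     "finite {3::nat}" "2 \<notin> {3::nat}" by auto
  note a = assms(1)[of "v 0" "v 1"] assms(1)[of "v 0" "v 2"] assms(1)[of "v 0" "v 3"]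
    assms(1)[of "v 1" "v 2"] assms(1)[of "v 1" "v 3"] assms(1)[of "v 2" "v 3"]
    assms(2)[of "v 0" "v 1"] assms(2)[of "v 0" "v 2"] assms(2)[of "v 0" "v 3"]
    assms(2)[of "v 1" "v 2"] assms(2)[of "v 1" "v 3"] assms(2)[of "v 2" "v 3"]
  show ?thesis
    unfolding wedge_def s
    unfolding sum_over_permutations_insert[OF n(1,2)]
    unfolding sum_over_permutations_insert[OF n(3,4)]
    unfolding sum_over_permutations_insert[OF n(5,6)]
    unfolding permutes_sing
    using a
    by (simp add: sign_swap_id permutation_swap_id sign_compose permutation_compose
        sign_id transpose_apply_other fact_numeral algebra_simps add_divide_distrib diff_divide_distrib
        flip: numeral_2_eq_2 numeral_3_eq_3)
qed

section \<open>The Cayley form and the Gram determinant on an orbit frame completed by a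
  velocity\<close>

lemma base_form_wedge:
  "base_form x i \<and>\<^sub>1 base_form x j =
     (\<lambda>v. base_coframe x i (v 0) * base_coframe x j (v 1) - base_coframe x i (v 1) * base_coframe x j (v 0))"
  unfolding base_form_def by (rule ext) (rule wedge1_apply)

lemma vertical_form_wedge:
  "vertical_form x i \<and>\<^sub>1 vertical_form x j =
     (\<lambda>v. vertical_coframe x i (v 0) * vertical_coframe x j (v 1)
        - vertical_coframe x i (v 1) * vertical_coframe x j (v 0))"
  unfolding vertical_form_def by (rule ext) (rule wedge1_apply)

lemma wedge2_minors:
  "((\<lambda>v. f1 (v 0) * f2 (v 1) - f1 (v 1) * f2 (v 0)) \<and>\<^sub>2 (\<lambda>v. g1 (v 0) * g2 (v 1) - g1 (v 1) * g2 (v 0))) v =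
     (let f = \<lambda>i j. f1 (v i) * f2 (v j) - f1 (v j) * f2 (v i);
          g = \<lambda>i j. g1 (v i) * g2 (v j) - g1 (v j) * g2 (v i)
      in f 0 1 * g 2 3 - f 0 2 * g 1 3 + f 0 3 * g 1 2 + f 1 2 * g 0 3 - f 1 3 * g 0 2 + f 2 3 * g 0 1)"
  using wedge2_apply[of "\<lambda>x y. f1 x * f2 y - f1 y * f2 x" "\<lambda>x y. g1 x * g2 y - g1 y * g2 x" v]
  by (simp add: Let_def)

text \<open>A difference of two decomposable 2-forms is the shape of both \<open>A_form\<close> and
  \<open>Omega_form\<close>.\<close>

lemma wedge2_differences:
  "((\<lambda>v. f1 (v 0) * f2 (v 1) - f1 (v 1) * f2 (v 0) - (f3 (v 0) * f4 (v 1) - f3 (v 1) * f4 (v 0))) \<and>\<^sub>2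
    (\<lambda>v. g1 (v 0) * g2 (v 1) - g1 (v 1) * g2 (v 0) - (g3 (v 0) * g4 (v 1) - g3 (v 1) * g4 (v 0)))) v =
     (let f = \<lambda>i j. f1 (v i) * f2 (v j) - f1 (v j) * f2 (v i) - (f3 (v i) * f4 (v j) - f3 (v j) * f4 (v i));
          g = \<lambda>i j. g1 (v i) * g2 (v j) - g1 (v j) * g2 (v i) - (g3 (v i) * g4 (v j) - g3 (v j) * g4 (v i))
      in f 0 1 * g 2 3 - f 0 2 * g 1 3 + f 0 3 * g 1 2 + f 1 2 * g 0 3 - f 1 3 * g 0 2 + f 2 3 * g 0 1)"
  using wedge2_apply[of
     "\<lambda>x y. f1 x * f2 y - f1 y * f2 x - (f3 x * f4 y - f3 y * f4 x)"
     "\<lambda>x y. g1 x * g2 y - g1 y * g2 x - (g3 x * g4 y - g3 y * g4 x)" v]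
  by (simp add: Let_def)

text \<open>Here \<open>v 0\<close>, \<open>v 1\<close>, \<open>v 2\<close> are the coordinate
  vectors of \<theta>, \<phi>, \<gamma>, and \<open>v 3\<close> is a velocity of the curve. Since
  \<open>v 2\<close> is vertical, the base volume form vanishes on the frame, and the two remaining
  coefficients of the Cayley form are \<open>p\<^sup>2\<close> and \<open>p * q\<close>. The number
  \<open>\<rho>\<close> is half the derivative of \<open>radius_sq\<close> along
  \<open>v 3\<close>.\<close>

lemma cayley_form_orbit_frame:
  fixes \<alpha> \<beta> \<theta> \<phi> a0 a1 a2 a3 \<alpha>' \<beta>' d0 d1 d2 d3 :: real
  defines "x \<equiv> (\<alpha>, \<beta>, \<theta>, \<phi>, a0, a1, a2, a3)"
    and "\<rho> \<equiv> a0 * d0 + a1 * d1 + a2 * d2 + a3 * d3"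
  assumes "v 0 = (0, 0, 1, 0, 0, 0, 0, 0)"
    and "v 1 = (0, 0, 0, 1, 0, 0, 0, 0)"
    and "v 2 = (0, 0, 0, 0, a1 / 2, - a0 / 2, - a3 / 2, a2 / 2)"
    and "v 3 = (\<alpha>', \<beta>', 0, 0, d0, d1, d2, d3)"
    and "16 * (c + radius_sq x) powr (- 4 / 5) = p\<^sup>2"
    and "20 * (c + radius_sq x) powr (1 / 5) = p * q"
  shows "cayley_form c x v = - (sin \<theta> / 2) * p *
     (\<rho> * (q * (cos \<alpha>)\<^sup>2 - p * (sin \<alpha>)\<^sup>2 * radius_sq x / 4) - q * cos \<alpha> * sin \<alpha> * radius_sq x * \<alpha>')"
proof -
  have *: "(\<Sum>ijk\<in>{(1::nat, 2::nat, 3::nat), (2, 3, 1), (3, 1, 2)}. F ijk) = F (1,2,3) + F (2,3,1) + F (3,1,2)"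
    for F :: "nat \<times> nat \<times> nat \<Rightarrow> real"
    by simp
  have V: "((vertical_form x 0 \<and>\<^sub>1 vertical_form x 1) \<and>\<^sub>2 (vertical_form x 2 \<and>\<^sub>1 vertical_form x 3)) v
     = sin \<theta> / 8 * (sin \<alpha>)\<^sup>2 * radius_sq x * \<rho>"
    unfolding vertical_form_wedge wedge2_minors Let_def assms
    by (simp add: Let_def power2_eq_square) (simp add: field_simps)
  have B: "((base_form x 0 \<and>\<^sub>1 base_form x 1) \<and>\<^sub>2 (base_form x 2 \<and>\<^sub>1 base_form x 3)) v = 0"
    unfolding base_form_wedge wedge2_minors Let_def assms
    by simp
  define b where "b i j = base_coframe x i (v j)" for i j
  define \<xi> where "\<xi> i j = vertical_coframe x i (v j)" for i j
  define C S Ct St where "C = cos \<alpha>" and "S = sin \<alpha>" and "Ct = cos \<theta>" and "St = sin \<theta>"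
  \<comment> \<open>The connection form \<rho>1 takes the value \<open>- h\<close> on
    \<open>v 3\<close>. The resulting vertical correction is \<open>- 2 * h\<close> times the
    vertical part of \<open>v 2\<close>, so it drops out of every minor that contains both columns 2
    and 3.\<close>
  define h where "h = C * \<beta>' / 2"
  note trig = C_def[symmetric] S_def[symmetric] Ct_def[symmetric] St_def[symmetric]
  have b: "b 0 0 = 0" "b 1 0 = 0" "b 2 0 = C" "b 3 0 = 0"
    "b 0 1 = 0" "b 1 1 = 0" "b 2 1 = 0" "b 3 1 = C * St"
    "b 0 2 = 0" "b 1 2 = 0" "b 2 2 = 0" "b 3 2 = 0"
    "b 0 3 = \<alpha>'" "b 1 3 = S * \<beta>'" "b 2 3 = 0" "b 3 3 = 0"
    unfolding b_def assms trig by (simp_all add: trig)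
  have xi: "\<xi> 0 0 = S * a2 / 2" "\<xi> 1 0 = S * a3 / 2" "\<xi> 2 0 = - S * a0 / 2" "\<xi> 3 0 = - S * a1 / 2"
    "\<xi> 0 1 = (Ct * a1 + S * St * a3) / 2" "\<xi> 1 1 = (- Ct * a0 - S * St * a2) / 2"
    "\<xi> 2 1 = (- Ct * a3 + S * St * a1) / 2" "\<xi> 3 1 = (Ct * a2 - S * St * a0) / 2"
    "\<xi> 0 2 = a1 / 2" "\<xi> 1 2 = - a0 / 2" "\<xi> 2 2 = - a3 / 2" "\<xi> 3 2 = a2 / 2"
    "\<xi> 0 3 = d0 - h * a1" "\<xi> 1 3 = d1 + h * a0" "\<xi> 2 3 = d2 + h * a3" "\<xi> 3 3 = d3 - h * a2"
    unfolding \<xi>_def assms trig h_def by (simp_all add: trig Let_def field_simps)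
  define f where "f i j k l = \<xi> i k * \<xi> j l - \<xi> i l * \<xi> j k" for i j k l
  \<comment> \<open>Column 2 of \<open>b\<close> is zero, so only minors of \<open>\<xi>\<close>
    that contain column 2 survive. The two terms with \<open>\<beta>'\<close> vanish separately once
    \<open>xi\<close> is inserted.\<close>
  have "(\<Sum>ijk\<in>{(1, 2, 3), (2, 3, 1), (3, 1, 2)}. (A_form x ijk \<and>\<^sub>2 Omega_form x ijk) v)
     = - C\<^sup>2 * St * (f 0 1 2 3 - f 2 3 2 3)
      - \<alpha>' * C * (f 0 2 1 2 - f 3 1 1 2) + C * St * S * \<beta>' * (f 0 2 0 2 - f 3 1 0 2)
      + S * \<beta>' * C * (f 0 3 1 2 - f 1 2 1 2) + \<alpha>' * C * St * (f 0 3 0 2 - f 1 2 0 2)"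
    unfolding * A_form_def Omega_form_def vertical_form_wedge base_form_wedge prod.case wedge2_differences
      Let_def \<xi>_def[symmetric] b_def[symmetric] f_def[symmetric] b
    by (simp add: power2_eq_square algebra_simps)
  also have "\<dots> = St / 2 * (\<alpha>' * C * S * radius_sq x - C\<^sup>2 * \<rho>)"
    unfolding f_def xi unfolding x_def \<rho>_def radius_sq.simps
    by (simp add: power2_eq_square field_simps)
  finally have A: "(\<Sum>ijk\<in>{(1, 2, 3), (2, 3, 1), (3, 1, 2)}. (A_form x ijk \<and>\<^sub>2 Omega_form x ijk) v)
     = St / 2 * (\<alpha>' * C * S * radius_sq x - C\<^sup>2 * \<rho>)" .
  show ?thesis
    unfolding cayley_form_def V B A assms(7,8) trig by (simp add: power2_eq_square field_simps)
qed

text \<open>\<open>G\<close> is the squared length of the \<theta> direction and, up to the factor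
  \<open>(sin \<theta>)\<^sup>2\<close>, of the \<phi> direction corrected by
  \<open>- cos \<theta>\<close> times the \<gamma> direction. These two and the \<gamma> direction
  are orthogonal, so the determinant is the product of their squared lengths with that of the part
  of \<open>X 4\<close> normal to them. The numbers \<open>e1\<close> and \<open>e2\<close> need no
  correction by the connection, because that correction is parallel to the \<gamma>
  direction.\<close>

lemma det_metric_orbit_frame:
  fixes \<alpha> \<beta> \<theta> \<phi> a0 a1 a2 a3 \<alpha>' \<beta>' d0 d1 d2 d3 p q :: real and X :: "4 \<Rightarrow> coords"
  defines "x \<equiv> (\<alpha>, \<beta>, \<theta>, \<phi>, a0, a1, a2, a3)"
    and "\<rho> \<equiv> a0 * d0 + a1 * d1 + a2 * d2 + a3 * d3"
    and "e1 \<equiv> a2 * d0 + a3 * d1 - a0 * d2 - a1 * d3"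
    and "e2 \<equiv> a3 * d0 - a2 * d1 + a1 * d2 - a0 * d3"
    and "G \<equiv> q * (cos \<alpha>)\<^sup>2 + p * (sin \<alpha>)\<^sup>2 * (a0\<^sup>2 + a1\<^sup>2 + a2\<^sup>2 + a3\<^sup>2) / 4"
  assumes X: "X 1 = (0, 0, 1, 0, 0, 0, 0, 0)"
    "X 2 = (0, 0, 0, 1, 0, 0, 0, 0)"
    "X 3 = (0, 0, 0, 0, a1 / 2, - a0 / 2, - a3 / 2, a2 / 2)"
    "X 4 = (\<alpha>', \<beta>', 0, 0, d0, d1, d2, d3)"
    and p: "4 * (c + radius_sq x) powr (- 2 / 5) = p"
    and q: "5 * (c + radius_sq x) powr (3 / 5) = q"
  shows "det (\<chi> i j. cayley_metric c x (X i) (X j)) = (sin \<theta>)\<^sup>2 / 4 * p * G *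
     (p * G * \<rho>\<^sup>2 + p * q * (cos \<alpha>)\<^sup>2 * (e1\<^sup>2 + e2\<^sup>2)
       + q * radius_sq x * G * (\<alpha>'\<^sup>2 + (sin \<alpha>)\<^sup>2 * \<beta>'\<^sup>2))"
proof -
  have sum4: "(\<Sum>i<4. F i) = F 0 + F 1 + F 2 + F 3" for F :: "nat \<Rightarrow> real"
    by (simp add: eval_nat_numeral)
  define r2 where "r2 = a0\<^sup>2 + a1\<^sup>2 + a2\<^sup>2 + a3\<^sup>2"
  define h where "h = cos \<alpha> * \<beta>' / 2"
  define e3 where "e3 = a1 * d0 - a0 * d1 - a3 * d2 + a2 * d3 - h * r2"
  define w where "w i = vertical_coframe x i (X 4)" for i
  define ww where "ww = (w 0)\<^sup>2 + (w 1)\<^sup>2 + (w 2)\<^sup>2 + (w 3)\<^sup>2"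
  have rx: "radius_sq x = r2" unfolding x_def r2_def by simp
  note gm = cayley_metric_def p q sum4
  have w: "w 0 = d0 - h * a1" "w 1 = d1 + h * a0"
    "w 2 = d2 + h * a3" "w 3 = d3 - h * a2"
    unfolding w_def x_def X h_def by (simp_all add: Let_def)
  \<comment> \<open>\<open>\<rho>, e1, e2, e3\<close> are the inner products of \<open>w\<close> with an orthogonal basis of vectors of squared
    length \<open>r2\<close>; using \<open>r2 * ww\<close> instead of \<open>ww\<close> makes all later identities polynomial.\<close>
  have rw: "r2 * ww = \<rho>\<^sup>2 + e1\<^sup>2 + e2\<^sup>2 + e3\<^sup>2"
    unfolding ww_def w r2_def \<rho>_def e1_def e2_def e3_def
    by (simp add: power2_eq_square algebra_simps)
  let ?g = "\<lambda>i j. cayley_metric c x (X i) (X j)"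
  have sym: "?g i j = ?g j i" for i j
    unfolding cayley_metric_def by (simp add: mult.commute)
  have g11: "?g 1 1 = G" unfolding gm unfolding X G_def x_def by (simp add: Let_def power2_eq_square field_simps)
  have g12: "?g 1 2 = 0" unfolding gm unfolding X x_def by (simp add: Let_def power2_eq_square field_simps)
  have g13: "?g 1 3 = 0" unfolding gm unfolding X x_def by (simp add: Let_def)
  have g14: "?g 1 4 = p * sin \<alpha> / 2 * e1" unfolding gm unfolding X x_def e1_def by (simp add: Let_def power2_eq_square field_simps)
  have g22: "?g 2 2 = (sin \<theta>)\<^sup>2 * G + (cos \<theta>)\<^sup>2 * p * r2 / 4"
    unfolding gm unfolding X x_def r2_def G_def by (simp add: Let_def power2_eq_square field_simps)
  have g23: "?g 2 3 = cos \<theta> * p * r2 / 4"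
    unfolding gm unfolding X x_def r2_def by (simp add: Let_def power2_eq_square field_simps)
  have g24: "?g 2 4 = sin \<theta> * p * sin \<alpha> / 2 * e2 + cos \<theta> * p * e3 / 2"
    unfolding gm unfolding X x_def e2_def e3_def h_def r2_def by (simp add: Let_def power2_eq_square field_simps)
  have g33: "?g 3 3 = p * r2 / 4"
    unfolding gm unfolding X x_def r2_def by (simp add: Let_def power2_eq_square field_simps)
  have g34: "?g 3 4 = p * e3 / 2"
    unfolding gm unfolding X x_def e3_def h_def r2_def by (simp add: Let_def power2_eq_square field_simps)
  have g44: "?g 4 4 = p * ww + q * (\<alpha>'\<^sup>2 + (sin \<alpha>)\<^sup>2 * \<beta>'\<^sup>2)"
    unfolding gm w_def[symmetric] ww_def unfolding X x_def by (simp add: power2_eq_square field_simps)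
  \<comment> \<open>The subtracted terms are the projections of \<open>X 4\<close> to the three
    orbit directions.\<close>
  have d: "det (\<chi> i j. ?g i j) = (sin \<theta>)\<^sup>2 / 4 * (G\<^sup>2 * p * (p * (r2 * ww) + q * r2 * (\<alpha>'\<^sup>2 + (sin \<alpha>)\<^sup>2 * \<beta>'\<^sup>2))
     - G * (p * r2) * (p\<^sup>2 * (sin \<alpha>)\<^sup>2 / 4 * (e1\<^sup>2 + e2\<^sup>2)) - G\<^sup>2 * p\<^sup>2 * e3\<^sup>2)"
    unfolding det_4 vec_lambda_beta sym[of 2 1] sym[of 3 1] sym[of 4 1] sym[of 3 2] sym[of 4 2] sym[of 4 3]
      g11 g12 g13 g14 g22 g23 g24 g33 g34 g44
    by (simp add: power2_eq_square field_simps)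
  have G: "G = q * (cos \<alpha>)\<^sup>2 + p * (sin \<alpha>)\<^sup>2 * r2 / 4"
    unfolding G_def r2_def by simp
  \<comment> \<open>Inserting \<open>rw\<close> cancels \<open>e3\<close>, and \<open>G - p * (sin
    \<alpha>)\<^sup>2 * r2 / 4 = q * (cos \<alpha>)\<^sup>2\<close> gives the coefficient of
    \<open>e1\<^sup>2 + e2\<^sup>2\<close>.\<close>
  show ?thesis unfolding d rx rw unfolding G by (simp add: power2_eq_square field_simps)
qed

section \<open>The coordinate frame of a union of orbits and the defect from being Cayley\<close>

lemma coord_frame_orbit_param:
  fixes y :: "real ^ 4"
  assumes deriv: "(\<alpha> has_real_derivative \<alpha>') (at (y $ 4))" "(\<beta> has_real_derivative \<beta>') (at (y $ 4))"
    "(s has_real_derivative s') (at (y $ 4))" "(t has_real_derivative t') (at (y $ 4))"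
    "(\<delta> has_real_derivative \<delta>') (at (y $ 4))"
  defines "\<psi> \<equiv> (\<delta> (y $ 4) - y $ 3) / 2" and "\<omega> \<equiv> (\<delta> (y $ 4) + y $ 3) / 2"
  defines "a0 \<equiv> s (y $ 4) * cos \<psi>" and "a1 \<equiv> s (y $ 4) * sin \<psi>"
    and "a2 \<equiv> t (y $ 4) * cos \<omega>" and "a3 \<equiv> t (y $ 4) * sin \<omega>"
  shows "coord_frame (orbit_param \<alpha> \<beta> s t \<delta>) y 1 = (0, 0, 1, 0, 0, 0, 0, 0)"
    and "coord_frame (orbit_param \<alpha> \<beta> s t \<delta>) y 2 = (0, 0, 0, 1, 0, 0, 0, 0)"
    and "coord_frame (orbit_param \<alpha> \<beta> s t \<delta>) y 3 = (0, 0, 0, 0, a1 / 2, - a0 / 2, - a3 / 2, a2 / 2)"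
    and "coord_frame (orbit_param \<alpha> \<beta> s t \<delta>) y 4 =
      (\<alpha>', \<beta>', 0, 0, s' * cos \<psi> - a1 * \<delta>' / 2, s' * sin \<psi> + a0 * \<delta>' / 2,
       t' * cos \<omega> - a3 * \<delta>' / 2, t' * sin \<omega> + a2 * \<delta>' / 2)"
proof -
  define L where "L h =
      (\<alpha>' * h $ 4, \<beta>' * h $ 4, h $ 1, h $ 2,
       s' * h $ 4 * cos \<psi> - a1 * ((\<delta>' * h $ 4 - h $ 3) / 2),
       s' * h $ 4 * sin \<psi> + a0 * ((\<delta>' * h $ 4 - h $ 3) / 2),
       t' * h $ 4 * cos \<omega> - a3 * ((\<delta>' * h $ 4 + h $ 3) / 2),
       t' * h $ 4 * sin \<omega> + a2 * ((\<delta>' * h $ 4 + h $ 3) / 2))" for h :: "real ^ 4"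
  have nth: "((\<lambda>y. y $ i) has_derivative (\<lambda>h. h $ i)) (at y)" for i :: 4
    by (intro bounded_linear_imp_has_derivative bounded_linear_vec_nth)
  have comp: "((\<lambda>y. f (y $ 4)) has_derivative (\<lambda>h. f' * h $ 4)) (at y)"
    if "(f has_real_derivative f') (at (y $ 4))" for f f'
    using has_derivative_compose[OF nth that[unfolded has_field_derivative_def]] .
  note d = deriv[THEN comp]
  have "(orbit_param \<alpha> \<beta> s t \<delta> has_derivative L) (at y)"
    unfolding orbit_param_def[abs_def] adapted_chart_def L_def[abs_def]
    by (intro has_derivative_Pair)
       (auto intro!: derivative_eq_intros nth d
         simp: a0_def a1_def a2_def a3_def \<psi>_def \<omega>_def fun_eq_iff)
  then have "frechet_derivative (orbit_param \<alpha> \<beta> s t \<delta>) (at y) = L"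
    using frechet_derivative_at by metis
  then have "coord_frame (orbit_param \<alpha> \<beta> s t \<delta>) y i = L (axis i 1)" for i
    unfolding coord_frame_def by simp
  then show "coord_frame (orbit_param \<alpha> \<beta> s t \<delta>) y 1 = (0, 0, 1, 0, 0, 0, 0, 0)"
    and "coord_frame (orbit_param \<alpha> \<beta> s t \<delta>) y 2 = (0, 0, 0, 1, 0, 0, 0, 0)"
    and "coord_frame (orbit_param \<alpha> \<beta> s t \<delta>) y 3 = (0, 0, 0, 0, a1 / 2, - a0 / 2, - a3 / 2, a2 / 2)"
    and "coord_frame (orbit_param \<alpha> \<beta> s t \<delta>) y 4 =
      (\<alpha>', \<beta>', 0, 0, s' * cos \<psi> - a1 * \<delta>' / 2, s' * sin \<psi> + a0 * \<delta>' / 2,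
       t' * cos \<omega> - a3 * \<delta>' / 2, t' * sin \<omega> + a2 * \<delta>' / 2)"
    by (simp_all add: L_def axis_def)
qed

text \<open>With \<open>p\<close> and \<open>q\<close> the two coefficients of \<open>g\<^sub>c\<close>, those of \<open>\<Phi>\<^sub>c\<close> are \<open>p\<^sup>2\<close>, \<open>q\<^sup>2\<close> and \<open>p q\<close>.\<close>

lemma orbit_param_cayley_form_and_det:
  fixes y :: "real ^ 4" and c \<alpha>' \<beta>' s' t' \<delta>' :: real and \<alpha> \<beta> s t \<delta> :: "real \<Rightarrow> real"
  defines "f \<equiv> orbit_param \<alpha> \<beta> s t \<delta>" and "\<tau> \<equiv> y $ 4"
  defines "S \<equiv> sin (\<alpha> \<tau>)" and "C \<equiv> cos (\<alpha> \<tau>)" and "r2 \<equiv> (s \<tau>)\<^sup>2 + (t \<tau>)\<^sup>2"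
  defines "p \<equiv> 4 * (c + r2) powr (- 2 / 5)" and "q \<equiv> 5 * (c + r2) powr (3 / 5)"
  defines "\<rho> \<equiv> s \<tau> * s' + t \<tau> * t'"
  assumes deriv: "(\<alpha> has_real_derivative \<alpha>') (at \<tau>)" "(\<beta> has_real_derivative \<beta>') (at \<tau>)"
    "(s has_real_derivative s') (at \<tau>)" "(t has_real_derivative t') (at \<tau>)"
    "(\<delta> has_real_derivative \<delta>') (at \<tau>)"
    and pos: "c + r2 > 0"
  defines "\<Phi> \<equiv> cayley_form c (f y) (\<lambda>n. coord_frame f y (of_nat (n + 1)))"
    and "\<Delta> \<equiv> det (\<chi> i j. cayley_metric c (f y) (coord_frame f y i) (coord_frame f y j))"
  shows "\<Phi> = - (sin (y $ 1) / 2) * p * (\<rho> * (q * C\<^sup>2 - p * S\<^sup>2 * r2 / 4) - q * C * S * r2 * \<alpha>')"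
    and "\<Delta> = \<Phi>\<^sup>2 + (sin (y $ 1))\<^sup>2 / 4 * p *
      (q * r2 * (p * \<rho> * C * S + (q * C\<^sup>2 - p * S\<^sup>2 * r2 / 4) * \<alpha>')\<^sup>2
       + (q * C\<^sup>2 + p * S\<^sup>2 * r2 / 4)\<^sup>2 * q * r2 * S\<^sup>2 * \<beta>'\<^sup>2
       + p * q * (q * C\<^sup>2 + p * S\<^sup>2 * r2 / 4) * C\<^sup>2 * ((s' * t \<tau> - s \<tau> * t')\<^sup>2 + (s \<tau> * t \<tau> * \<delta>')\<^sup>2))"
proof -
  define \<psi> \<omega> where "\<psi> = (\<delta> \<tau> - y $ 3) / 2" and "\<omega> = (\<delta> \<tau> + y $ 3) / 2"
  define a0 a1 a2 a3 where "a0 = s \<tau> * cos \<psi>" and "a1 = s \<tau> * sin \<psi>"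
    and "a2 = t \<tau> * cos \<omega>" and "a3 = t \<tau> * sin \<omega>"
  define d0 d1 d2 d3 where "d0 = s' * cos \<psi> - a1 * \<delta>' / 2" and "d1 = s' * sin \<psi> + a0 * \<delta>' / 2"
    and "d2 = t' * cos \<omega> - a3 * \<delta>' / 2" and "d3 = t' * sin \<omega> + a2 * \<delta>' / 2"
  note a = a0_def a1_def a2_def a3_def and d = d0_def d1_def d2_def d3_def
  define x where "x = (\<alpha> \<tau>, \<beta> \<tau>, y $ 1, y $ 2, a0, a1, a2, a3)"
  define G where "G = q * C\<^sup>2 + p * S\<^sup>2 * r2 / 4"
  have fy: "f y = x"
    unfolding f_def orbit_param_def adapted_chart_def x_def a \<psi>_def \<omega>_def \<tau>_def by simp
  note frame = coord_frame_orbit_param[OF deriv[unfolded \<tau>_def], folded \<tau>_def f_def,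
      folded \<psi>_def \<omega>_def, folded a, folded d]
  have sum_a: "a0\<^sup>2 + a1\<^sup>2 + a2\<^sup>2 + a3\<^sup>2 = r2"
  proof -
    \<comment> \<open>The sums of squares equal to 1 are kept explicit on the right, so that both
      sides agree as polynomials in sines and cosines.\<close>
    have "a0\<^sup>2 + a1\<^sup>2 + a2\<^sup>2 + a3\<^sup>2
        = (s \<tau>)\<^sup>2 * ((sin \<psi>)\<^sup>2 + (cos \<psi>)\<^sup>2) + (t \<tau>)\<^sup>2 * ((sin \<omega>)\<^sup>2 + (cos \<omega>)\<^sup>2)"
      unfolding a by (simp only: power2_eq_square)
        (simp add: algebra_simps del: sin_cos_squared_add3)
    then show ?thesis unfolding r2_def by simp
  qed
  have rx: "radius_sq x = r2"
    unfolding x_def by (simp add: sum_a)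
  have \<rho>: "a0 * d0 + a1 * d1 + a2 * d2 + a3 * d3 = \<rho>"
  proof -
    have "a0 * d0 + a1 * d1 + a2 * d2 + a3 * d3
        = s \<tau> * s' * ((sin \<psi>)\<^sup>2 + (cos \<psi>)\<^sup>2) + t \<tau> * t' * ((sin \<omega>)\<^sup>2 + (cos \<omega>)\<^sup>2)"
      unfolding a d by (simp only: power2_eq_square)
        (simp add: algebra_simps del: sin_cos_squared_add3)
    then show ?thesis unfolding \<rho>_def by simp
  qed
  have e: "(a2 * d0 + a3 * d1 - a0 * d2 - a1 * d3)\<^sup>2 + (a3 * d0 - a2 * d1 + a1 * d2 - a0 * d3)\<^sup>2
      = (s' * t \<tau> - s \<tau> * t')\<^sup>2 + (s \<tau> * t \<tau> * \<delta>')\<^sup>2"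
  proof -
    \<comment> \<open>The two expressions are the image of the pair
      \<open>s' * t \<tau> - s \<tau> * t'\<close>, \<open>s \<tau> * t \<tau> * \<delta>'\<close>
      under an orthogonal map with angle \<open>\<omega> - \<psi>\<close>, which is the orbit
      coordinate \<gamma>. Their sum of squares is therefore constant on the orbit.\<close>
    have 1: "a2 * d0 + a3 * d1 - a0 * d2 - a1 * d3
        = (s' * t \<tau> - s \<tau> * t') * cos (\<omega> - \<psi>) + s \<tau> * t \<tau> * \<delta>' * sin (\<omega> - \<psi>)"
      and 2: "a3 * d0 - a2 * d1 + a1 * d2 - a0 * d3
        = (s' * t \<tau> - s \<tau> * t') * sin (\<omega> - \<psi>) - s \<tau> * t \<tau> * \<delta>' * cos (\<omega> - \<psi>)"
      unfolding a d by (simp_all add: cos_diff sin_diff field_simps)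
    have "(u * cos z + v * sin z)\<^sup>2 + (u * sin z - v * cos z)\<^sup>2 = (u\<^sup>2 + v\<^sup>2) * ((sin z)\<^sup>2 + (cos z)\<^sup>2)"
      for u v z :: real
      by (simp only: power2_eq_square)
        (simp add: algebra_simps del: sin_cos_squared_add3)
    then show ?thesis
      unfolding 1 2 by simp
  qed
  have p2: "16 * (c + r2) powr (- 4 / 5) = p\<^sup>2" and pq: "20 * (c + r2) powr (1 / 5) = p * q"
    using pos unfolding p_def q_def by (simp_all add: power2_eq_square flip: powr_add)
  show *: "\<Phi> = - (sin (y $ 1) / 2) * p * (\<rho> * (q * C\<^sup>2 - p * S\<^sup>2 * r2 / 4) - q * C * S * r2 * \<alpha>')"
  proof -
    have "\<Phi> = - (sin (y $ 1) / 2) * p * ((a0 * d0 + a1 * d1 + a2 * d2 + a3 * d3) *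
        (q * C\<^sup>2 - p * S\<^sup>2 * radius_sq x / 4) - q * C * S * radius_sq x * \<alpha>')"
      unfolding \<Phi>_def fy unfolding x_def S_def C_def
      by (rule cayley_form_orbit_frame) (simp_all add: frame sum_a p2[simplified] pq)
    then show ?thesis unfolding \<rho> rx .
  qed
  have "\<Delta> = (sin (y $ 1))\<^sup>2 / 4 * p * G * (p * G * \<rho>\<^sup>2
      + p * q * C\<^sup>2 * ((s' * t \<tau> - s \<tau> * t')\<^sup>2 + (s \<tau> * t \<tau> * \<delta>')\<^sup>2)
      + q * r2 * G * (\<alpha>'\<^sup>2 + S\<^sup>2 * \<beta>'\<^sup>2))"
  proof -
    have "\<Delta> = (sin (y $ 1))\<^sup>2 / 4 * p * (q * C\<^sup>2 + p * S\<^sup>2 * (a0\<^sup>2 + a1\<^sup>2 + a2\<^sup>2 + a3\<^sup>2) / 4) *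
       (p * (q * C\<^sup>2 + p * S\<^sup>2 * (a0\<^sup>2 + a1\<^sup>2 + a2\<^sup>2 + a3\<^sup>2) / 4) * (a0 * d0 + a1 * d1 + a2 * d2 + a3 * d3)\<^sup>2
        + p * q * C\<^sup>2 * ((a2 * d0 + a3 * d1 - a0 * d2 - a1 * d3)\<^sup>2 + (a3 * d0 - a2 * d1 + a1 * d2 - a0 * d3)\<^sup>2)
        + q * radius_sq x * (q * C\<^sup>2 + p * S\<^sup>2 * (a0\<^sup>2 + a1\<^sup>2 + a2\<^sup>2 + a3\<^sup>2) / 4) * (\<alpha>'\<^sup>2 + S\<^sup>2 * \<beta>'\<^sup>2))"
      unfolding \<Delta>_def fy unfolding x_def S_def C_def
      by (rule det_metric_orbit_frame) (simp_all add: frame sum_a p_def q_def)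
    then show ?thesis unfolding \<rho> rx e sum_a G_def .
  qed
  then show "\<Delta> = \<Phi>\<^sup>2 + (sin (y $ 1))\<^sup>2 / 4 * p *
      (q * r2 * (p * \<rho> * C * S + (q * C\<^sup>2 - p * S\<^sup>2 * r2 / 4) * \<alpha>')\<^sup>2
       + (q * C\<^sup>2 + p * S\<^sup>2 * r2 / 4)\<^sup>2 * q * r2 * S\<^sup>2 * \<beta>'\<^sup>2
       + p * q * (q * C\<^sup>2 + p * S\<^sup>2 * r2 / 4) * C\<^sup>2 * ((s' * t \<tau> - s \<tau> * t')\<^sup>2 + (s \<tau> * t \<tau> * \<delta>')\<^sup>2))"
    \<comment> \<open>With \<open>Y = q * C\<^sup>2 - p * S\<^sup>2 * r2 / 4\<close> one has
      \<open>G\<^sup>2 = Y\<^sup>2 + p * q * r2 * C\<^sup>2 * S\<^sup>2\<close>. The product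
      identity for sums of two squares then splits \<open>G\<^sup>2 * (p * \<rho>\<^sup>2 + q * r2 *
      \<alpha>'\<^sup>2)\<close> into
      \<open>p * (\<rho> * Y - q * C * S * r2 * \<alpha>')\<^sup>2\<close>, which accounts for
      \<open>\<Phi>\<^sup>2\<close>, and
      \<open>q * r2 * (p * \<rho> * C * S + Y * \<alpha>')\<^sup>2\<close>.\<close>
    unfolding * G_def by (simp add: power2_eq_square field_simps)
qed

section \<open>The first integral\<close>

text \<open>The hypothesis \<open>ratio\<close> says that \<open>s / t\<close> is stationary at
  \<open>\<tau>\<close>. Then the factor of \<open>H\<close> is stationary too, and all terms of the
  derivative share a positive factor.\<close>

lemma first_integral_has_derivative:
  fixes \<alpha> s t H :: "real \<Rightarrow> real" and \<tau> :: real
  defines "S \<equiv> sin (\<alpha> \<tau>)" and "C \<equiv> cos (\<alpha> \<tau>)" and "r2 \<equiv> (s \<tau>)\<^sup>2 + (t \<tau>)\<^sup>2"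
  assumes \<alpha>: "(\<alpha> has_real_derivative \<alpha>') (at \<tau>)" and s: "(s has_real_derivative s') (at \<tau>)"
    and t: "(t has_real_derivative t') (at \<tau>)"
    and H: "(H has_real_derivative (C * S) powr (3 / 2)) (at (\<alpha> \<tau>))"
    and pos: "S > 0" "C > 0" "s \<tau> > 0" "t \<tau> > 0"
    and ratio: "s' * t \<tau> = s \<tau> * t'"
  shows "((\<lambda>\<tau>. 2 * sin (\<alpha> \<tau>) powr (5 / 2) * cos (\<alpha> \<tau>) powr (1 / 2) * (s \<tau> * t \<tau>)
                 + 5 * c * (s \<tau> * t \<tau> / ((s \<tau>)\<^sup>2 + (t \<tau>)\<^sup>2)) * H (\<alpha> \<tau>)) has_real_derivative
     s \<tau> * t \<tau> / r2 * S powr (3 / 2) * C powr (- 1 / 2) *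
       (4 * (s \<tau> * s' + t \<tau> * t') * C * S + (5 * (c + r2) * C\<^sup>2 - S\<^sup>2 * r2) * \<alpha>')) (at \<tau>)"
proof -
  \<comment> \<open>Every fractional power that occurs is \<open>U\<close> or \<open>V\<close> times
    an integral power of \<open>S\<close> or \<open>C\<close>, so the final comparison is one of
    rational expressions.\<close>
  define U V where "U = S powr (3 / 2)" and "V = C powr (- 1 / 2)"
  \<comment> \<open>The common logarithmic derivative of \<open>s\<close> and
    \<open>t\<close>.\<close>
  define z where "z = s' / s \<tau>"
  have r2: "r2 > 0" using pos by (simp add: r2_def add_pos_pos)
  have s': "s' = z * s \<tau>" and t': "t' = z * t \<tau>"
    using ratio pos by (simp_all add: z_def field_simps)
  have S: "S powr (5 / 2) = U * S"
    using pos powr_add[of S "3 / 2" 1] by (simp add: U_def)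
  have C1: "C powr (1 / 2) = V * C" and C3: "C powr (3 / 2) = V * C\<^sup>2"
    using pos powr_add[of C "- 1 / 2" 1] powr_add[of C "- 1 / 2" 2] by (simp_all add: V_def)
  have H': "((\<lambda>\<tau>. H (\<alpha> \<tau>)) has_real_derivative V * C\<^sup>2 * U * \<alpha>') (at \<tau>)"
    using DERIV_chain2[OF H \<alpha>] pos by (simp add: powr_mult C3 U_def)
  have dS: "((\<lambda>\<tau>. sin (\<alpha> \<tau>) powr (5 / 2)) has_real_derivative 5 / 2 * U * (C * \<alpha>')) (at \<tau>)"
    using DERIV_chain2[OF has_real_derivative_powr[of "sin (\<alpha> \<tau>)" "5 / 2"] DERIV_chain2[OF DERIV_sin \<alpha>]] pos
    by (simp add: S_def C_def U_def)
  have dC: "((\<lambda>\<tau>. cos (\<alpha> \<tau>) powr (1 / 2)) has_real_derivative 1 / 2 * V * (- S * \<alpha>')) (at \<tau>)"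
    using DERIV_chain2[OF has_real_derivative_powr[of "cos (\<alpha> \<tau>)" "1 / 2"] DERIV_chain2[OF DERIV_cos \<alpha>]] pos
    by (simp add: S_def C_def V_def)
  have dq: "((\<lambda>\<tau>. s \<tau> * t \<tau> / ((s \<tau>)\<^sup>2 + (t \<tau>)\<^sup>2)) has_real_derivative 0) (at \<tau>)"
    using r2 by (auto intro!: derivative_eq_intros s t simp: s' t' r2_def)
       (simp_all add: power2_eq_square algebra_simps)
  have "((\<lambda>\<tau>. 2 * sin (\<alpha> \<tau>) powr (5 / 2) * cos (\<alpha> \<tau>) powr (1 / 2) * (s \<tau> * t \<tau>)
                 + 5 * c * (s \<tau> * t \<tau> / ((s \<tau>)\<^sup>2 + (t \<tau>)\<^sup>2)) * H (\<alpha> \<tau>)) has_real_derivative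
     (2 * (5 / 2 * U * (C * \<alpha>')) * (V * C) + 1 / 2 * V * (- S * \<alpha>') * (2 * (U * S))) * (s \<tau> * t \<tau>)
     + (s' * t \<tau> + t' * s \<tau>) * (2 * (U * S) * (V * C))
     + 5 * c * (s \<tau> * t \<tau> / r2) * (V * C\<^sup>2 * U * \<alpha>')) (at \<tau>)"
    by (rule DERIV_cong[OF DERIV_add[OF
            DERIV_mult[OF DERIV_mult[OF DERIV_cmult[OF dS, of 2] dC] DERIV_mult[OF s t]]
            DERIV_mult[OF DERIV_cmult[OF dq, of "5 * c"] H']]])
       (simp add: S[unfolded S_def] C1[unfolded C_def] r2_def S_def C_def)
  also have "(2 * (5 / 2 * U * (C * \<alpha>')) * (V * C) + 1 / 2 * V * (- S * \<alpha>') * (2 * (U * S))) * (s \<tau> * t \<tau>)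
     + (s' * t \<tau> + t' * s \<tau>) * (2 * (U * S) * (V * C))
     + 5 * c * (s \<tau> * t \<tau> / r2) * (V * C\<^sup>2 * U * \<alpha>')
     = s \<tau> * t \<tau> / r2 * U * V *
       (4 * (z * r2) * C * S + (5 * (c + r2) * C\<^sup>2 - S\<^sup>2 * r2) * \<alpha>')"
    using r2 unfolding s' t' by (simp add: power2_eq_square field_simps)
  also have "z * r2 = s \<tau> * s' + t \<tau> * t'"
    unfolding s' t' r2_def by (simp add: power2_eq_square algebra_simps)
  finally show ?thesis unfolding U_def V_def .
qed

section \<open>Constancy, sign and smoothness on intervals\<close>

lemma has_real_derivative_constant_on:
  fixes f :: "real \<Rightarrow> real"
  assumes "f constant_on S" "open S" "x \<in> S" "(f has_real_derivative D) (at x)"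
  shows "D = 0"
proof -
  obtain k where "\<And>y. y \<in> S \<Longrightarrow> f y = k"
    using assms(1) unfolding constant_on_def by blast
  then have "((\<lambda>_. k) has_real_derivative D) (at x)"
    using assms by (auto intro: has_field_derivative_transform_within_open)
  then show ?thesis
    using DERIV_const DERIV_unique by blast
qed

lemma constant_on_if_derivative_zero:
  fixes f :: "real \<Rightarrow> real"
  assumes "convex S" "\<And>x. x \<in> S \<Longrightarrow> (f has_real_derivative 0) (at x)"
  shows "f constant_on S"
  using has_field_derivative_zero_constant[OF assms(1), of f] has_field_derivative_at_within[OF assms(2)]
  unfolding constant_on_def by blast

lemma continuous_nonzero_constant_sign:
  fixes f :: "real \<Rightarrow> real"
  assumes "continuous_on S f" "connected S" "\<And>x. x \<in> S \<Longrightarrow> f x \<noteq> 0"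
  shows "(\<forall>x\<in>S. f x > 0) \<or> (\<forall>x\<in>S. f x < 0)"
proof (rule ccontr)
  assume "\<not> ?thesis"
  then obtain x y where "x \<in> S" "y \<in> S" "f x \<le> 0" "0 \<le> f y" by force
  then have "0 \<in> f ` S"
    using connectedD_interval[OF connected_continuous_image[OF assms(1,2)], of "f x" "f y" 0] by blast
  then show False using assms(3) by force
qed

lemma smooth_on_has_real_derivative:
  assumes "smooth_on f S" "open S" "x \<in> S"
  shows "(f has_real_derivative deriv f x) (at x)"
proof -
  have "f differentiable_on S"
    using assms(1)[unfolded smooth_on_def, rule_format, of 0] by simp
  then have "f differentiable (at x)"
    using assms(2,3) by (meson differentiable_on_eq_differentiable_at)
  then show ?thesis
    by (metis DERIV_deriv_iff_real_differentiable)
qed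

lemma smooth_on_continuous_deriv:
  assumes "smooth_on f S"
  shows "continuous_on S (deriv f)"
  using assms[unfolded smooth_on_def, rule_format, of 1] differentiable_imp_continuous_on by auto

section \<open>The Cayley condition along a curve\<close>

theorem theorem5p14:
  fixes c \<epsilon> :: real and \<alpha> \<beta> s t \<delta> H :: "real \<Rightarrow> real"
  assumes "c \<ge> 0" and "\<epsilon> > 0"
    and "\<And>f. f \<in> {\<alpha>, \<beta>, s, t, \<delta>} \<Longrightarrow> smooth_on f {-\<epsilon><..<\<epsilon>}"
    and "\<And>\<tau>. \<tau> \<in> {-\<epsilon><..<\<epsilon>} \<Longrightarrow>
           (deriv \<alpha> \<tau>, deriv \<beta> \<tau>, deriv s \<tau>, deriv t \<tau>, deriv \<delta> \<tau>) \<noteq> (0, 0, 0, 0, 0)"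
    and "\<And>\<tau>. \<tau> \<in> {-\<epsilon><..<\<epsilon>} \<Longrightarrow> \<alpha> \<tau> \<in> {0<..<pi / 2} \<and> s \<tau> > 0 \<and> t \<tau> > 0"
    and "\<And>x. x \<in> {0<..<pi / 2} \<Longrightarrow>
           (H has_real_derivative (cos x * sin x) powr (3 / 2)) (at x)"
  shows "cayley_up_to_orientation c (orbit_domain \<epsilon>) (orbit_param \<alpha> \<beta> s t \<delta>) \<longleftrightarrow>
           \<beta> constant_on {-\<epsilon><..<\<epsilon>} \<and>
           \<delta> constant_on {-\<epsilon><..<\<epsilon>} \<and>
           (\<lambda>\<tau>. s \<tau> / t \<tau>) constant_on {-\<epsilon><..<\<epsilon>} \<and>
           (\<lambda>\<tau>. 2 * sin (\<alpha> \<tau>) powr (5 / 2) * cos (\<alpha> \<tau>) powr (1 / 2) * (s \<tau> * t \<tau>)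
                 + 5 * c * (s \<tau> * t \<tau> / ((s \<tau>)\<^sup>2 + (t \<tau>)\<^sup>2)) * H (\<alpha> \<tau>))
             constant_on {-\<epsilon><..<\<epsilon>}"
proof -
  define I where "I = {-\<epsilon><..<\<epsilon>}"
  define f where "f = orbit_param \<alpha> \<beta> s t \<delta>"
  define \<Phi> where "\<Phi> y = cayley_form c (f y) (\<lambda>n. coord_frame f y (of_nat (n + 1)))" for y
  define \<Delta> where "\<Delta> y = det (\<chi> i j. cayley_metric c (f y) (coord_frame f y i) (coord_frame f y j))" for y
  define F where "F \<tau> = 2 * sin (\<alpha> \<tau>) powr (5 / 2) * cos (\<alpha> \<tau>) powr (1 / 2) * (s \<tau> * t \<tau>)
                 + 5 * c * (s \<tau> * t \<tau> / ((s \<tau>)\<^sup>2 + (t \<tau>)\<^sup>2)) * H (\<alpha> \<tau>)" for \<tau>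
  define S C r2 \<rho> where "S \<tau> = sin (\<alpha> \<tau>)" and "C \<tau> = cos (\<alpha> \<tau>)" and "r2 \<tau> = (s \<tau>)\<^sup>2 + (t \<tau>)\<^sup>2"
    and "\<rho> \<tau> = s \<tau> * deriv s \<tau> + t \<tau> * deriv t \<tau>" for \<tau>
  define p q where "p \<tau> = 4 * (c + r2 \<tau>) powr (- 2 / 5)" and "q \<tau> = 5 * (c + r2 \<tau>) powr (3 / 5)" for \<tau>
  define G where "G \<tau> = q \<tau> * (C \<tau>)\<^sup>2 + p \<tau> * (S \<tau>)\<^sup>2 * r2 \<tau> / 4" for \<tau>
  define Y where "Y \<tau> = q \<tau> * (C \<tau>)\<^sup>2 - p \<tau> * (S \<tau>)\<^sup>2 * r2 \<tau> / 4" for \<tau>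
  \<comment> \<open>Up to factors that are nonzero on the domain, \<open>K\<close> is the value of
    the Cayley form and \<open>Q\<close> the defect \<open>\<Delta> - \<Phi>\<^sup>2\<close>. Both
    depend on \<open>\<tau>\<close> alone.\<close>
  define K where "K \<tau> = \<rho> \<tau> * Y \<tau> - q \<tau> * C \<tau> * S \<tau> * r2 \<tau> * deriv \<alpha> \<tau>" for \<tau>
  define J where "J \<tau> = p \<tau> * \<rho> \<tau> * C \<tau> * S \<tau> + Y \<tau> * deriv \<alpha> \<tau>" for \<tau>
  define Z where "Z \<tau> = deriv s \<tau> * t \<tau> - s \<tau> * deriv t \<tau>" for \<tau>
  define Q where "Q \<tau> = q \<tau> * r2 \<tau> * (J \<tau>)\<^sup>2 + (G \<tau>)\<^sup>2 * q \<tau> * r2 \<tau> * (S \<tau>)\<^sup>2 * (deriv \<beta> \<tau>)\<^sup>2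
      + p \<tau> * q \<tau> * G \<tau> * (C \<tau>)\<^sup>2 * ((Z \<tau>)\<^sup>2 + (s \<tau> * t \<tau> * deriv \<delta> \<tau>)\<^sup>2)" for \<tau>
  have I: "open I" "convex I" "connected I"
    unfolding I_def by auto
  have st: "s \<tau> > 0" "t \<tau> > 0" if "\<tau> \<in> I" for \<tau>
    using assms(5) that unfolding I_def by auto
  have SC: "S \<tau> > 0" "C \<tau> > 0" if "\<tau> \<in> I" for \<tau>
    using assms(5)[of \<tau>] that unfolding I_def S_def C_def by (auto intro!: sin_gt_zero cos_gt_zero)
  have r2: "r2 \<tau> > 0" "c + r2 \<tau> > 0" if "\<tau> \<in> I" for \<tau>
  proof -
    show "r2 \<tau> > 0" using st[OF that] unfolding r2_def by (simp add: add_pos_pos)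
    with \<open>c \<ge> 0\<close> show "c + r2 \<tau> > 0" by simp
  qed
  have pq: "p \<tau> > 0" "q \<tau> > 0" "G \<tau> > 0" if "\<tau> \<in> I" for \<tau>
  proof -
    show "p \<tau> > 0" "q \<tau> > 0" using r2[OF that] unfolding p_def q_def by simp_all
    then show "G \<tau> > 0" using r2[OF that] SC[OF that] unfolding G_def by (simp add: add_pos_pos)
  qed
  have D: "(g has_real_derivative deriv g \<tau>) (at \<tau>)" if "g \<in> {\<alpha>, \<beta>, s, t, \<delta>}" "\<tau> \<in> I" for g \<tau>
    using smooth_on_has_real_derivative[OF assms(3)] that unfolding I_def by auto
  have cont: "continuous_on I g" if "g \<in> {\<alpha>, \<beta>, s, t, \<delta>}" for g
    using D[OF that] by (meson DERIV_isCont continuous_at_imp_continuous_on)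
  have cont': "continuous_on I (deriv g)" if "g \<in> {\<alpha>, \<beta>, s, t, \<delta>}" for g
    using smooth_on_continuous_deriv[OF assms(3)[OF that]] unfolding I_def .
  have \<Phi>: "\<Phi> y = - (sin (y $ 1) / 2) * p (y $ 4) * K (y $ 4)"
    and \<Delta>: "\<Delta> y = (\<Phi> y)\<^sup>2 + (sin (y $ 1))\<^sup>2 / 4 * p (y $ 4) * Q (y $ 4)"
    if "y \<in> orbit_domain \<epsilon>" for y
  proof -
    have *: "y $ 4 \<in> I" using that unfolding orbit_domain_def I_def by auto
    note orbit = orbit_param_cayley_form_and_det[where y = y, OF D[of \<alpha>] D[of \<beta>] D[of s] D[of t] D[of \<delta>]
        r2(2)[unfolded r2_def], simplified *, simplified]
    show "\<Phi> y = - (sin (y $ 1) / 2) * p (y $ 4) * K (y $ 4)"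
      using orbit(1)
      unfolding \<Phi>_def f_def p_def q_def K_def Y_def \<rho>_def S_def C_def r2_def by simp
    show "\<Delta> y = (\<Phi> y)\<^sup>2 + (sin (y $ 1))\<^sup>2 / 4 * p (y $ 4) * Q (y $ 4)"
      using orbit(2)
      unfolding \<Phi>_def \<Delta>_def f_def Q_def J_def G_def Z_def p_def q_def K_def Y_def \<rho>_def S_def C_def r2_def
      by simp
  qed
  have Q_nonneg: "Q \<tau> \<ge> 0" if "\<tau> \<in> I" for \<tau>
    unfolding Q_def using pq[OF that] r2[OF that] by simp
  have Q_eq_0: "Q \<tau> = 0 \<longleftrightarrow> deriv \<beta> \<tau> = 0 \<and> deriv \<delta> \<tau> = 0 \<and> Z \<tau> = 0 \<and> J \<tau> = 0" if "\<tau> \<in> I" for \<tau>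
  proof -
    have "Q \<tau> = 0 \<longleftrightarrow> q \<tau> * r2 \<tau> * (J \<tau>)\<^sup>2 = 0 \<and> (G \<tau>)\<^sup>2 * q \<tau> * r2 \<tau> * (S \<tau>)\<^sup>2 * (deriv \<beta> \<tau>)\<^sup>2 = 0
        \<and> p \<tau> * q \<tau> * G \<tau> * (C \<tau>)\<^sup>2 * ((Z \<tau>)\<^sup>2 + (s \<tau> * t \<tau> * deriv \<delta> \<tau>)\<^sup>2) = 0"
      unfolding Q_def using pq[OF that] r2[OF that]
      by (subst add_nonneg_eq_0_iff, simp, simp, subst add_nonneg_eq_0_iff) auto
    also have "\<dots> \<longleftrightarrow> deriv \<beta> \<tau> = 0 \<and> deriv \<delta> \<tau> = 0 \<and> Z \<tau> = 0 \<and> J \<tau> = 0"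
      using pq[OF that] r2[OF that] SC[OF that] st[OF that]
      by (auto simp: sum_power2_eq_zero_iff)
    finally show ?thesis .
  qed
  \<comment> \<open>Factoring out the common power turns \<open>J\<close> into the bracket in the
    derivative of \<open>F\<close>.\<close>
  have J_eq: "J \<tau> = (c + r2 \<tau>) powr (- 2 / 5) *
      (4 * \<rho> \<tau> * C \<tau> * S \<tau> + (5 * (c + r2 \<tau>) * (C \<tau>)\<^sup>2 - (S \<tau>)\<^sup>2 * r2 \<tau>) * deriv \<alpha> \<tau>)"
    if "\<tau> \<in> I" for \<tau>
  proof -
    have "(c + r2 \<tau>) powr (3 / 5) = (c + r2 \<tau>) powr (- 2 / 5) * (c + r2 \<tau>)"
      using powr_add[of "c + r2 \<tau>" "- 2 / 5" 1] r2[OF that] by simp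
    then show ?thesis
      unfolding J_def Y_def p_def q_def by (simp add: algebra_simps)
  qed
  have dF: "(F has_real_derivative
      s \<tau> * t \<tau> / r2 \<tau> * S \<tau> powr (3 / 2) * C \<tau> powr (- 1 / 2) * (c + r2 \<tau>) powr (2 / 5) * J \<tau>) (at \<tau>)"
    if "\<tau> \<in> I" "Z \<tau> = 0" for \<tau>
  proof -
    have H: "(H has_real_derivative (C \<tau> * S \<tau>) powr (3 / 2)) (at (\<alpha> \<tau>))"
      using assms(5,6) that unfolding C_def S_def I_def by blast
    have "(c + r2 \<tau>) powr (2 / 5) * (c + r2 \<tau>) powr (- 2 / 5) = 1"
      using r2[OF that(1)] by (simp flip: powr_add)
    then have "E = (c + r2 \<tau>) powr (2 / 5) * ((c + r2 \<tau>) powr (- 2 / 5) * E)" for E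
      by (simp flip: mult.assoc)
    moreover have "(F has_real_derivative s \<tau> * t \<tau> / r2 \<tau> * S \<tau> powr (3 / 2) * C \<tau> powr (- 1 / 2) *
        (4 * \<rho> \<tau> * C \<tau> * S \<tau> + (5 * (c + r2 \<tau>) * (C \<tau>)\<^sup>2 - (S \<tau>)\<^sup>2 * r2 \<tau>) * deriv \<alpha> \<tau>)) (at \<tau>)"
      unfolding F_def[abs_def] S_def C_def r2_def \<rho>_def
      by (rule first_integral_has_derivative)
        (use that D[of _ \<tau>] H SC[OF that(1)] st[OF that(1)] in \<open>auto simp: S_def C_def Z_def\<close>)
    ultimately show ?thesis
      unfolding J_eq[OF that(1)] by (metis mult.assoc)
  qed
  have dratio: "((\<lambda>\<tau>. s \<tau> / t \<tau>) has_real_derivative Z \<tau> / (t \<tau>)\<^sup>2) (at \<tau>)" if "\<tau> \<in> I" for \<tau>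
    using DERIV_divide[OF D D, of s \<tau> t] st[OF that] that by (simp add: Z_def power2_eq_square)
  have K_nonzero: "K \<tau> \<noteq> 0" if "\<tau> \<in> I" "Q \<tau> = 0" for \<tau>
  proof
    assume K: "K \<tau> = 0"
    note pos = pq[OF that(1)] r2[OF that(1)] SC[OF that(1)] st[OF that(1)]
    have vanish: "deriv \<beta> \<tau> = 0" "deriv \<delta> \<tau> = 0" "Z \<tau> = 0" "J \<tau> = 0"
      using Q_eq_0 that by auto
    \<comment> \<open>This combination eliminates \<open>Y\<close>, whose sign is unknown, and
      leaves a positive definite form in \<open>\<rho> \<tau>\<close> and
      \<open>deriv \<alpha> \<tau>\<close>.\<close>
    have "\<rho> \<tau> * J \<tau> - deriv \<alpha> \<tau> * K \<tau>
        = C \<tau> * S \<tau> * (p \<tau> * (\<rho> \<tau>)\<^sup>2 + q \<tau> * r2 \<tau> * (deriv \<alpha> \<tau>)\<^sup>2)"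
      unfolding J_def K_def by (simp add: power2_eq_square algebra_simps)
    then have "p \<tau> * (\<rho> \<tau>)\<^sup>2 + q \<tau> * r2 \<tau> * (deriv \<alpha> \<tau>)\<^sup>2 = 0"
      using K vanish pos by simp
    then have "\<rho> \<tau> = 0" "deriv \<alpha> \<tau> = 0"
      using pos by (simp_all add: add_nonneg_eq_0_iff)
    \<comment> \<open>As \<open>r2 \<tau>\<close> is positive, \<open>\<rho> \<tau>\<close> and
      \<open>Z \<tau>\<close> determine the derivatives of \<open>s\<close> and \<open>t\<close>.
      All five derivatives then vanish, against the regularity of the curve.\<close>
    moreover have "s \<tau> * \<rho> \<tau> + t \<tau> * Z \<tau> = r2 \<tau> * deriv s \<tau>" "t \<tau> * \<rho> \<tau> - s \<tau> * Z \<tau> = r2 \<tau> * deriv t \<tau>"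
      unfolding \<rho>_def Z_def r2_def by (simp_all add: power2_eq_square algebra_simps)
    ultimately have "deriv s \<tau> = 0" "deriv t \<tau> = 0"
      using vanish pos by auto
    then show False
      using assms(4) that(1) vanish \<open>deriv \<alpha> \<tau> = 0\<close> unfolding I_def by blast
  qed
  have K_cont: "continuous_on I K"
  proof -
    note cont = cont[of \<alpha>] cont[of s] cont[of t] cont'[of \<alpha>] cont'[of s] cont'[of t]
    have "c + ((s \<tau>)\<^sup>2 + (t \<tau>)\<^sup>2) \<noteq> 0" if "\<tau> \<in> I" for \<tau>
      using r2(2)[OF that] by (simp add: r2_def)
    then show ?thesis
      unfolding K_def Y_def \<rho>_def p_def q_def S_def C_def r2_def
      by (auto intro!: continuous_intros cont[simplified])
  qed
  have "cayley_up_to_orientation c (orbit_domain \<epsilon>) f \<longleftrightarrow> (\<forall>\<tau>\<in>I. Q \<tau> = 0)"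
  proof
    assume "cayley_up_to_orientation c (orbit_domain \<epsilon>) f"
    then obtain \<sigma> :: real where \<sigma>: "\<sigma> \<in> {1, -1}" "\<And>y. y \<in> orbit_domain \<epsilon> \<Longrightarrow> \<Phi> y = \<sigma> * sqrt (\<Delta> y)"
      unfolding cayley_up_to_orientation_def \<Phi>_def \<Delta>_def by blast
    show "\<forall>\<tau>\<in>I. Q \<tau> = 0"
    proof
      fix \<tau> assume "\<tau> \<in> I"
      \<comment> \<open>One point of each orbit suffices; \<theta> is chosen with sine 1, and 0 is
        an admissible value of \<phi> and \<gamma>.\<close>
      define y :: "real ^ 4" where "y = (\<chi> i. if i = 1 then pi / 2 else if i = 4 then \<tau> else 0)"
      have y: "y $ 1 = pi / 2" "y $ 4 = \<tau>" by (simp_all add: y_def)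
      have "y \<in> orbit_domain \<epsilon>"
        using \<open>\<tau> \<in> I\<close> unfolding orbit_domain_def I_def by (simp add: y_def)
      note * = \<sigma>(2)[OF this] \<Delta>[OF this]
      \<comment> \<open>Needed before squaring, since \<open>sqrt\<close> is extended to negative
        numbers as an odd function.\<close>
      have "\<Delta> y \<ge> 0"
        using *(2) Q_nonneg pq(1) \<open>\<tau> \<in> I\<close> by (simp add: y less_imp_le)
      then have "\<Delta> y = (\<Phi> y)\<^sup>2"
        using *(1) \<sigma>(1) by (auto simp: power_mult_distrib)
      then show "Q \<tau> = 0"
        using *(2) pq(1)[OF \<open>\<tau> \<in> I\<close>] by (simp add: y)
    qed
  next
    assume Q: "\<forall>\<tau>\<in>I. Q \<tau> = 0"
    have sgn: "(\<forall>\<tau>\<in>I. K \<tau> > 0) \<or> (\<forall>\<tau>\<in>I. K \<tau> < 0)"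
      using continuous_nonzero_constant_sign K_cont I(3) K_nonzero Q by blast
    \<comment> \<open>The sign is opposite to that of \<open>K\<close>, because
      \<open>\<Phi>\<close> is a negative multiple of \<open>K\<close>.\<close>
    define \<sigma> :: real where "\<sigma> = (if \<forall>\<tau>\<in>I. K \<tau> > 0 then -1 else 1)"
    have "\<Phi> y = \<sigma> * sqrt (\<Delta> y)" if "y \<in> orbit_domain \<epsilon>" for y
    proof -
      have y: "y $ 4 \<in> I" "sin (y $ 1) > 0"
        using that unfolding orbit_domain_def I_def by (auto intro: sin_gt_zero)
      have "sqrt (\<Delta> y) = \<bar>\<Phi> y\<bar>"
        using \<Delta>[OF that] Q y by simp
      also have "\<dots> = sin (y $ 1) / 2 * p (y $ 4) * \<bar>K (y $ 4)\<bar>"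
        using \<Phi>[OF that] y pq(1)[OF y(1)] by (simp add: abs_mult)
      finally show ?thesis
        using sgn y(1) \<Phi>[OF that] unfolding \<sigma>_def by fastforce
    qed
    moreover have "\<sigma> \<in> {1, -1}" by (simp add: \<sigma>_def)
    ultimately show "cayley_up_to_orientation c (orbit_domain \<epsilon>) f"
      unfolding cayley_up_to_orientation_def \<Phi>_def \<Delta>_def by blast
  qed
  also have "\<dots> \<longleftrightarrow> \<beta> constant_on I \<and> \<delta> constant_on I \<and> (\<lambda>\<tau>. s \<tau> / t \<tau>) constant_on I \<and> F constant_on I"
  proof
    assume Q: "\<forall>\<tau>\<in>I. Q \<tau> = 0"
    show "\<beta> constant_on I \<and> \<delta> constant_on I \<and> (\<lambda>\<tau>. s \<tau> / t \<tau>) constant_on I \<and> F constant_on I"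
      using Q Q_eq_0 D[of \<beta>] D[of \<delta>] dratio dF
      by (intro conjI constant_on_if_derivative_zero I(2)) fastforce+
  next
    assume const: "\<beta> constant_on I \<and> \<delta> constant_on I \<and> (\<lambda>\<tau>. s \<tau> / t \<tau>) constant_on I \<and> F constant_on I"
    show "\<forall>\<tau>\<in>I. Q \<tau> = 0"
    proof
      fix \<tau> assume \<tau>: "\<tau> \<in> I"
      note zero = has_real_derivative_constant_on[OF _ I(1) \<tau>]
      have "deriv \<beta> \<tau> = 0" "deriv \<delta> \<tau> = 0"
        using const zero D \<tau> by blast+
      \<comment> \<open>This comes before \<open>J\<close>, as \<open>dF\<close> gives the
        derivative of \<open>F\<close> only where \<open>Z\<close> vanishes. The coefficient of
        \<open>J\<close> there is positive.\<close>
      moreover have Z: "Z \<tau> = 0"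
        using const zero[OF _ dratio[OF \<tau>]] st[OF \<tau>] by auto
      moreover have "J \<tau> = 0"
        using const zero[OF _ dF[OF \<tau> Z]] st[OF \<tau>] SC[OF \<tau>] r2[OF \<tau>] by auto
      ultimately show "Q \<tau> = 0"
        using Q_eq_0[OF \<tau>] by simp
    qed
  qed
  finally show ?thesis
    unfolding f_def I_def F_def[abs_def] .
qed

end
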